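(* Let $\mathsf Q$ be a quasivariety and let $C$ be a clone of term operations of $\mathsf Q$. If $\mathbf F_{\mathsf Q}(\omega)$ has the Prucnal property relative to $C$, then $\mathsf Q$ is $C$-structurally complete.
   Context: $\mathbf F_{\mathsf Q}(\omega)$ is the free algebra of $\mathsf Q$ on countably many generators. A $\mathsf Q$-congruence of $\mathbf A\in\mathsf Q$ is a congruence $\theta$ with $\mathbf A/\theta\in\mathsf Q$; $\mathrm{Con}_{\mathsf Q}(\mathbf A)$ is the algebraic lattice of $\mathsf Q$-congruences and $\vartheta^{\mathsf Q}_{\mathbf A}(a,b)$ is the least $\mathsf Q$-congruence containing $(a,b)$. The term clone of $\mathsf Q$ is the clone of term operations on $\mathbf F_{\mathsf Q}(\omega)$ (generated by the fundamental operations); a clone of term operations of $\mathsf Q$ is a subclone $C$ of it, interpreted in each algebra of $\mathsf Q$. Let $T$ be a set of generators of the clone $C$ and let $\mathbf A^T$ be the reduct of $\mathbf A$ to the operations in $T$. $\mathbf A\in\mathsf Q$ has the Prucnal property relative to $C$ if for every $n\ge1$ there is a term $t_n(x_1,\dots,x_n,y_1,\dots,y_n,z)$ such that for any compact $\theta=\bigvee_{i=1}^n\vartheta^{\mathsf Q}_{\mathbf A}(a_i,b_i)$ in $\mathrm{Con}_{\mathsf Q}(\mathbf A)$ (join taken in $\mathrm{Con}_{\mathsf Q}(\mathbf A)$, $a_i,b_i\in A$): (i) the map $\sigma_n:c\mapsto t_n(a_1,\dots,a_n,b_1,\dots,b_n,c)$ is an endomorphism of $\mathbf A^T$; (ii)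 $\ker(\sigma_n)=\theta$. A $C$-quasiequation is a quasiequation containing only operations from $C$. $\mathsf Q$ is $C$-structurally complete if for every $C$-quasiequation $\Phi$, $\mathbf F_{\mathsf Q}(\omega)\models\Phi$ implies $\mathsf Q\models\Phi$. *)

theory Defs
  imports Main "HOL-Library.FuncSet"
begin

text \<open>
  A signature assigns arities to its operation symbols; its symbols are the members of \<open>dom L\<close>,
  so the empty signature is included.  Operations take lists as arguments.
\<close>

type_synonym 'f signature = "'f \<Rightarrow> nat option"

datatype ('f, 'v) trm = Var 'v | App 'f "('f, 'v) trm list"

inductive_set terms :: "'f signature \<Rightarrow> 'v set \<Rightarrow> ('f, 'v) trm set"
  for L :: "'f signature" and X :: "'v set" where
  Var: "x \<in> X \<Longrightarrow> Var x \<in> terms L X"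
| App: "L f = Some (length ts) \<Longrightarrow> \<forall>t\<in>set ts. t \<in> terms L X \<Longrightarrow> App f ts \<in> terms L X"

record ('f, 'a) algebra =
  univ :: "'a set"
  opr :: "'f \<Rightarrow> 'a list \<Rightarrow> 'a"

definition tuples :: "'a set \<Rightarrow> nat \<Rightarrow> 'a list set" where
  "tuples A n = {xs. length xs = n \<and> set xs \<subseteq> A}"

definition algebra_over :: "'f signature \<Rightarrow> ('f, 'a) algebra \<Rightarrow> bool" where
  "algebra_over L A \<longleftrightarrow> univ A \<noteq> {} \<and>
     (\<forall>f n. L f = Some n \<longrightarrow> (\<forall>xs\<in>tuples (univ A) n. opr A f xs \<in> univ A))"

primrec eval :: "('f, 'a) algebra \<Rightarrow> ('v \<Rightarrow> 'a) \<Rightarrow> ('f, 'v) trm \<Rightarrow> 'a" where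
  "eval A h (Var x) = h x"
| "eval A h (App f ts) = opr A f (map (eval A h) ts)"


section \<open>Quasiequations and quasivarieties\<close>

text \<open>
  The pair \<open>([(p\<^sub>1, q\<^sub>1), \<dots>, (p\<^sub>k, q\<^sub>k)], (s, t))\<close> is the quasiequation
  \<open>p\<^sub>1 \<approx> q\<^sub>1 \<and> \<dots> \<and> p\<^sub>k \<approx> q\<^sub>k \<longrightarrow> s \<approx> t\<close>; equations are the case of no premises.
\<close>

type_synonym 'f equation = "('f, nat) trm \<times> ('f, nat) trm"
type_synonym 'f quasiequation = "'f equation list \<times> 'f equation"

definition quasiequations :: "'f signature \<Rightarrow> 'f quasiequation set" where
  "quasiequations L =
     {(ps, e). \<forall>(s, t)\<in>insert e (set ps). s \<in> terms L UNIV \<and> t \<in> terms L UNIV}"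

definition satisfies :: "('f, 'a) algebra \<Rightarrow> 'f quasiequation \<Rightarrow> bool" where
  "satisfies A \<Phi> \<longleftrightarrow> (\<forall>h. range h \<subseteq> univ A \<longrightarrow>
     (\<forall>(p, q)\<in>set (fst \<Phi>). eval A h p = eval A h q) \<longrightarrow>
     eval A h (fst (snd \<Phi>)) = eval A h (snd (snd \<Phi>)))"

text \<open>
  A quasivariety is the class of all models of a set \<open>\<Sigma>\<close> of quasiequations.  It contains algebras
  on carriers of every type, so it is given by \<open>\<Sigma>\<close> and its membership predicate is polymorphic.
\<close>

definition in_quasivariety ::
    "'f signature \<Rightarrow> 'f quasiequation set \<Rightarrow> ('f, 'a) algebra \<Rightarrow> bool" where
  "in_quasivariety L \<Sigma> A \<longleftrightarrow> algebra_over L A \<and> (\<forall>\<Phi>\<in>\<Sigma>. satisfies A \<Phi>)"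


section \<open>Relative congruences\<close>

definition congruence :: "'f signature \<Rightarrow> ('f, 'a) algebra \<Rightarrow> ('a \<times> 'a) set \<Rightarrow> bool" where
  "congruence L A \<theta> \<longleftrightarrow> equiv (univ A) \<theta> \<and>
     (\<forall>f n. L f = Some n \<longrightarrow> (\<forall>xs\<in>tuples (univ A) n. \<forall>ys\<in>tuples (univ A) n.
        (\<forall>i<n. (xs ! i, ys ! i) \<in> \<theta>) \<longrightarrow> (opr A f xs, opr A f ys) \<in> \<theta>))"

definition quot_alg :: "('f, 'a) algebra \<Rightarrow> ('a \<times> 'a) set \<Rightarrow> ('f, 'a set) algebra" where
  "quot_alg A \<theta> = \<lparr>univ = univ A // \<theta>,
     opr = \<lambda>f Xs. \<theta> `` {opr A f (map (\<lambda>X. SOME x. x \<in> X) Xs)}\<rparr>"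

definition Con :: "'f signature \<Rightarrow> 'f quasiequation set \<Rightarrow> ('f, 'a) algebra
    \<Rightarrow> ('a \<times> 'a) set set" where
  "Con L \<Sigma> A = {\<theta>. congruence L A \<theta> \<and> in_quasivariety L \<Sigma> (quot_alg A \<theta>)}"

definition principal_Con :: "'f signature \<Rightarrow> 'f quasiequation set \<Rightarrow> ('f, 'a) algebra
    \<Rightarrow> 'a \<Rightarrow> 'a \<Rightarrow> ('a \<times> 'a) set" where
  "principal_Con L \<Sigma> A a b = \<Inter>{\<theta> \<in> Con L \<Sigma> A. (a, b) \<in> \<theta>}"

definition join_Con :: "'f signature \<Rightarrow> 'f quasiequation set \<Rightarrow> ('f, 'a) algebra
    \<Rightarrow> ('a \<times> 'a) set set \<Rightarrow> ('a \<times> 'a) set" where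
  "join_Con L \<Sigma> A S = \<Inter>{\<theta> \<in> Con L \<Sigma> A. \<forall>\<phi>\<in>S. \<phi> \<subseteq> \<theta>}"


section \<open>The free algebra on countably many generators\<close>

definition term_algebra :: "'f signature \<Rightarrow> ('f, ('f, nat) trm) algebra" where
  "term_algebra L = \<lparr>univ = terms L UNIV, opr = App\<rparr>"

text \<open>
  The quotient of the absolutely free algebra by its least relative congruence; the generators are
  the classes of the variables \<open>Var i\<close> with \<open>i :: nat\<close>.
\<close>

definition free_algebra :: "'f signature \<Rightarrow> 'f quasiequation set
    \<Rightarrow> ('f, ('f, nat) trm set) algebra" where
  "free_algebra L \<Sigma> = quot_alg (term_algebra L) (\<Inter>(Con L \<Sigma> (term_algebra L)))"


section \<open>Clones\<close>

text \<open>
  An \<open>n\<close>-ary operation on \<open>A\<close> is a pair \<open>(n, f)\<close> with \<open>f\<close> undefined outside the \<open>n\<close>-tuples over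
  \<open>A\<close>, so that equality of pairs is equality of operations.  Nullary operations are allowed, and
  so are clones consisting of operations of positive arity only.
\<close>

type_synonym 'a operation = "nat \<times> ('a list \<Rightarrow> 'a)"

definition operations :: "'a set \<Rightarrow> 'a operation set" where
  "operations A = {(n, f). f \<in> tuples A n \<rightarrow>\<^sub>E A}"

definition projection :: "'a set \<Rightarrow> nat \<Rightarrow> nat \<Rightarrow> 'a list \<Rightarrow> 'a" where
  "projection A n i = restrict (\<lambda>xs. xs ! i) (tuples A n)"

definition superposition ::
    "'a set \<Rightarrow> nat \<Rightarrow> ('a list \<Rightarrow> 'a) \<Rightarrow> ('a list \<Rightarrow> 'a) list \<Rightarrow> 'a list \<Rightarrow> 'a" where
  "superposition A m f gs = restrict (\<lambda>xs. f (map (\<lambda>g. g xs) gs)) (tuples A m)"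

definition clone :: "'a set \<Rightarrow> 'a operation set \<Rightarrow> bool" where
  "clone A C \<longleftrightarrow> C \<subseteq> operations A \<and>
     (\<forall>n. \<forall>i<n. (n, projection A n i) \<in> C) \<and>
     (\<forall>m n f gs. (n, f) \<in> C \<and> length gs = n \<and> (\<forall>g\<in>set gs. (m, g) \<in> C) \<longrightarrow>
        (m, superposition A m f gs) \<in> C)"

definition clone_generated :: "'a set \<Rightarrow> 'a operation set \<Rightarrow> 'a operation set" where
  "clone_generated A G = \<Inter>{C. clone A C \<and> G \<subseteq> C}"

definition fundamental_operations :: "'f signature \<Rightarrow> ('f, 'a) algebra \<Rightarrow> 'a operation set" where
  "fundamental_operations L A =
     {(n, restrict (opr A f) (tuples (univ A) n)) | f n. L f = Some n}"

definition term_clone :: "'f signature \<Rightarrow> 'f quasiequation set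
    \<Rightarrow> ('f, nat) trm set operation set" where
  "term_clone L \<Sigma> = clone_generated (univ (free_algebra L \<Sigma>))
     (fundamental_operations L (free_algebra L \<Sigma>))"

definition clone_of_term_operations :: "'f signature \<Rightarrow> 'f quasiequation set
    \<Rightarrow> ('f, nat) trm set operation set \<Rightarrow> bool" where
  "clone_of_term_operations L \<Sigma> C \<longleftrightarrow>
     clone (univ (free_algebra L \<Sigma>)) C \<and> C \<subseteq> term_clone L \<Sigma>"

definition term_operation :: "('f, 'a) algebra \<Rightarrow> nat \<Rightarrow> ('f, nat) trm \<Rightarrow> 'a list \<Rightarrow> 'a" where
  "term_operation A n t = restrict (\<lambda>xs. eval A (\<lambda>i. xs ! i) t) (tuples (univ A) n)"

text \<open>
  A term operation of the free algebra is interpreted in an algebra \<open>A\<close> of the quasivariety through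
  any term that represents it.  The choice is immaterial, because terms that induce the same
  operation on the free algebra induce the same operation on \<open>A\<close>.
\<close>

definition interpretation_in :: "'f signature \<Rightarrow> 'f quasiequation set \<Rightarrow> ('f, 'a) algebra
    \<Rightarrow> ('f, nat) trm set operation \<Rightarrow> 'a list \<Rightarrow> 'a" where
  "interpretation_in L \<Sigma> A = (\<lambda>(n, f). term_operation A n
     (SOME t. t \<in> terms L {..<n} \<and> term_operation (free_algebra L \<Sigma>) n t = f))"

text \<open>
  A set of operations is used as a signature of its own, each operation being its own symbol.
  \<open>clone_reduct L \<Sigma> A\<close>, taken over the signature \<open>clone_sig T\<close>, is the reduct of \<open>A\<close> to \<open>T\<close>.
\<close>

definition clone_sig :: "'a operation set \<Rightarrow> 'a operation signature" where
  "clone_sig T = (\<lambda>c. if c \<in> T then Some (fst c) else None)"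

definition clone_reduct :: "'f signature \<Rightarrow> 'f quasiequation set \<Rightarrow> ('f, 'a) algebra
    \<Rightarrow> (('f, nat) trm set operation, 'a) algebra" where
  "clone_reduct L \<Sigma> A = \<lparr>univ = univ A, opr = interpretation_in L \<Sigma> A\<rparr>"


section \<open>The Prucnal property and structural completeness\<close>

definition endomorphism :: "'f signature \<Rightarrow> ('f, 'a) algebra \<Rightarrow> ('a \<Rightarrow> 'a) \<Rightarrow> bool" where
  "endomorphism L A \<sigma> \<longleftrightarrow> \<sigma> \<in> univ A \<rightarrow> univ A \<and>
     (\<forall>f n. L f = Some n \<longrightarrow>
        (\<forall>xs\<in>tuples (univ A) n. \<sigma> (opr A f xs) = opr A f (map \<sigma> xs)))"

definition kernel :: "'a set \<Rightarrow> ('a \<Rightarrow> 'b) \<Rightarrow> ('a \<times> 'a) set" where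
  "kernel A \<sigma> = {(c, d). c \<in> A \<and> d \<in> A \<and> \<sigma> c = \<sigma> d}"

text \<open>
  The property relative to the clone generated by \<open>T\<close>.  The term \<open>t\<close> is in the full language of the
  quasivariety; its variables \<open>0, \<dots>, 2 n\<close> stand for \<open>x\<^sub>1, \<dots>, x\<^sub>n, y\<^sub>1, \<dots>, y\<^sub>n, z\<close>.  The finite
  joins of principal relative congruences are exactly the compact relative congruences.
\<close>

definition prucnal_property :: "'f signature \<Rightarrow> 'f quasiequation set
    \<Rightarrow> ('f, nat) trm set operation set \<Rightarrow> ('f, 'a) algebra \<Rightarrow> bool" where
  "prucnal_property L \<Sigma> T A \<longleftrightarrow>
     (\<forall>n\<ge>1. \<exists>t\<in>terms L {..<2 * n + 1}.
        \<forall>a\<in>tuples (univ A) n. \<forall>b\<in>tuples (univ A) n.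
          let \<theta> = join_Con L \<Sigma> A {principal_Con L \<Sigma> A (a ! i) (b ! i) | i. i < n};
              \<sigma> = (\<lambda>c. eval A (\<lambda>i. (a @ b @ [c]) ! i) t)
          in endomorphism (clone_sig T) (clone_reduct L \<Sigma> A) \<sigma> \<and> kernel (univ A) \<sigma> = \<theta>)"

text \<open>
  The type argument fixes the carrier type of the algebras over which validity in the quasivariety
  is tested; a theorem in which it is a type variable covers all algebras of the quasivariety.
\<close>

definition structurally_complete :: "'b itself \<Rightarrow> 'f signature \<Rightarrow> 'f quasiequation set
    \<Rightarrow> ('f, nat) trm set operation set \<Rightarrow> bool" where
  "structurally_complete _ L \<Sigma> C \<longleftrightarrow>
     (\<forall>\<Phi>\<in>quasiequations (clone_sig C).
        satisfies (clone_reduct L \<Sigma> (free_algebra L \<Sigma>)) \<Phi> \<longrightarrow>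
        (\<forall>A :: ('f, 'b) algebra. in_quasivariety L \<Sigma> A \<longrightarrow> satisfies (clone_reduct L \<Sigma> A) \<Phi>))"

end

theory Submission
  imports Defs
begin

text \<open>
  Let \<open>F\<close> be the free algebra with free generators \<open>x\<^sub>i\<close>, and let a valuation \<open>h\<close> in an algebra \<open>A\<close>
  of the quasivariety make the premises \<open>p\<^sub>i \<approx> q\<^sub>i\<close> of a quasiequation in the language of \<open>C\<close> true.
  Freeness gives a homomorphism \<open>\<phi>\<close> from \<open>F\<close> to \<open>A\<close> with \<open>\<phi> x\<^sub>i = h i\<close> (\<open>free_extension\<close>); its kernel
  is a relative congruence of \<open>F\<close> (\<open>kernel_in_Con\<close>).  Let \<open>a\<^sub>i\<close>, \<open>b\<^sub>i\<close> be the values of \<open>p\<^sub>i\<close>, \<open>q\<^sub>i\<close>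
  at the free generators.  The kernel of \<open>\<phi>\<close> contains every pair \<open>(a\<^sub>i, b\<^sub>i)\<close>, hence it contains the
  relative congruence \<open>\<theta>\<close> that these pairs generate.

  The Prucnal property turns \<open>\<theta>\<close> into the kernel of an endomorphism \<open>\<sigma>\<close> of the reduct of \<open>F\<close> to
  \<open>T\<close>, which is also an endomorphism of the reduct to \<open>C\<close>, as \<open>T\<close> generates \<open>C\<close>
  (\<open>endomorphism_of_generated_reduct\<close>).  So \<open>\<sigma>\<close> plays the role of a unifier: the
  valuation \<open>i \<mapsto> \<sigma> x\<^sub>i\<close> satisfies the premises in \<open>F\<close>, and if the quasiequation is valid in \<open>F\<close>,
  then it also satisfies the conclusion \<open>s \<approx> t\<close>.  This says that the values of \<open>s\<close> and \<open>t\<close> at the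
  free generators are related by the kernel \<open>\<theta>\<close> of \<open>\<sigma>\<close>, thus by the kernel of \<open>\<phi>\<close>.  Applying \<open>\<phi>\<close>
  gives the conclusion in \<open>A\<close> at \<open>h\<close>.
\<close>

section \<open>Homomorphisms and quotients\<close>

definition homomorphism ::
    "'f signature \<Rightarrow> ('f, 'a) algebra \<Rightarrow> ('f, 'b) algebra \<Rightarrow> ('a \<Rightarrow> 'b) \<Rightarrow> bool" where
  "homomorphism L A B \<phi> \<longleftrightarrow> \<phi> \<in> univ A \<rightarrow> univ B \<and>
     (\<forall>f n. L f = Some n \<longrightarrow>
        (\<forall>xs\<in>tuples (univ A) n. \<phi> (opr A f xs) = opr B f (map \<phi> xs)))"

lemma endomorphism_iff_homomorphism: "endomorphism L A \<sigma> \<longleftrightarrow> homomorphism L A A \<sigma>"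
  by (simp add: endomorphism_def homomorphism_def)

lemma homomorphism_in_univ:
  assumes "homomorphism L A B \<phi>" and "x \<in> univ A"
  shows "\<phi> x \<in> univ B"
  using assms by (auto simp: homomorphism_def)

lemma homomorphism_opr:
  assumes "homomorphism L A B \<phi>" and "L f = Some n" and "xs \<in> tuples (univ A) n"
  shows "\<phi> (opr A f xs) = opr B f (map \<phi> xs)"
  using assms by (auto simp: homomorphism_def)

lemma map_in_tuples:
  assumes "xs \<in> tuples A n" and "\<And>x. x \<in> A \<Longrightarrow> \<phi> x \<in> B"
  shows "map \<phi> xs \<in> tuples B n"
  using assms by (auto simp: tuples_def)

lemma opr_in_univ:
  assumes "algebra_over L A" and "L f = Some n" and "xs \<in> tuples (univ A) n"
  shows "opr A f xs \<in> univ A"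
  using assms by (auto simp: algebra_over_def)

lemma eval_in_univ:
  assumes "algebra_over L A" and "t \<in> terms L X" and "\<And>x. x \<in> X \<Longrightarrow> h x \<in> univ A"
  shows "eval A h t \<in> univ A"
  using assms(2)
proof (induction rule: terms.induct)
  case (Var x)
  then show ?case using assms(3) by simp
next
  case (App f ts)
  then have "map (eval A h) ts \<in> tuples (univ A) (length ts)"
    by (auto simp: tuples_def)
  then show ?case using opr_in_univ[OF assms(1) App(1)] by simp
qed

lemma homomorphism_eval:
  assumes "algebra_over L A" and "homomorphism L A B \<phi>"
    and "t \<in> terms L X" and h: "\<And>x. x \<in> X \<Longrightarrow> h x \<in> univ A"
  shows "\<phi> (eval A h t) = eval B (\<lambda>x. \<phi> (h x)) t"
  using assms(3)
proof (induction rule: terms.induct)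
  case (Var x)
  then show ?case by simp
next
  case (App f ts)
  have "map (eval A h) ts \<in> tuples (univ A) (length ts)"
    using App eval_in_univ[OF assms(1), of _ X h] h by (auto simp: tuples_def)
  then have "\<phi> (opr A f (map (eval A h) ts)) = opr B f (map \<phi> (map (eval A h) ts))"
    using homomorphism_opr[OF assms(2) App(1)] by blast
  moreover have "map \<phi> (map (eval A h) ts) = map (eval B (\<lambda>x. \<phi> (h x))) ts"
    using App by simp
  ultimately show ?case by (simp only: eval.simps)
qed

lemma eval_cong_terms:
  assumes "t \<in> terms L X" and "\<And>x. x \<in> X \<Longrightarrow> h x = g x"
  shows "eval A h t = eval A g t"
  using assms(1)
proof (induction rule: terms.induct)
  case (App f ts)
  then have "map (eval A h) ts = map (eval A g) ts" by simp
  then show ?case by (simp del: map_eq_conv)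
qed (simp add: assms(2))

lemma congruence_equiv: "congruence L A \<theta> \<Longrightarrow> equiv (univ A) \<theta>"
  by (simp add: congruence_def)

lemma SOME_in_class:
  assumes "equiv A \<theta>" and "x \<in> A"
  shows "(x, SOME y. y \<in> \<theta> `` {x}) \<in> \<theta>"
  using someI[of "\<lambda>y. y \<in> \<theta> `` {x}", OF equiv_class_self[OF assms]] by simp

lemma univ_quot_alg [simp]: "univ (quot_alg A \<theta>) = univ A // \<theta>"
  by (simp add: quot_alg_def)

lemma class_homomorphism:
  assumes "algebra_over L A" and \<theta>: "congruence L A \<theta>"
  shows "homomorphism L A (quot_alg A \<theta>) (\<lambda>x. \<theta> `` {x})"
  unfolding homomorphism_def
proof (intro conjI allI impI ballI)
  show "(\<lambda>x. \<theta> `` {x}) \<in> univ A \<rightarrow> univ (quot_alg A \<theta>)"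
    by (auto intro: quotientI)
next
  fix f n xs
  assume f: "L f = Some n" and xs: "xs \<in> tuples (univ A) n"
  note eq = congruence_equiv[OF \<theta>]
  let ?ys = "map (\<lambda>X. SOME x. x \<in> X) (map (\<lambda>x. \<theta> `` {x}) xs)"
  have rel: "(x, SOME y. y \<in> \<theta> `` {x}) \<in> \<theta>" if "x \<in> univ A" for x
    using SOME_in_class[OF eq that] .
  have ys: "?ys \<in> tuples (univ A) n"
    using map_in_tuples[OF xs, of "\<lambda>x. SOME y. y \<in> \<theta> `` {x}" "univ A"] rel eq
    by (auto simp: comp_def equiv_def refl_on_def)
  have "\<forall>i<n. (xs ! i, ?ys ! i) \<in> \<theta>"
    using xs rel by (auto simp: tuples_def subset_iff simp del: Image_singleton_iff)
  then have "(opr A f xs, opr A f ?ys) \<in> \<theta>"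
    using \<theta> f xs ys unfolding congruence_def by blast
  then show "\<theta> `` {opr A f xs} = opr (quot_alg A \<theta>) f (map (\<lambda>x. \<theta> `` {x}) xs)"
    using equiv_class_eq[OF eq] by (simp add: quot_alg_def)
qed

lemma classes_tuple:
  assumes "Xs \<in> tuples (A // \<theta>) n"
  obtains xs where "xs \<in> tuples A n" and "Xs = map (\<lambda>x. \<theta> `` {x}) xs"
proof -
  have "\<forall>X\<in>set Xs. \<exists>x\<in>A. X = \<theta> `` {x}"
    using assms by (auto simp: tuples_def elim!: quotientE)
  then obtain r where "\<forall>X\<in>set Xs. r X \<in> A \<and> X = \<theta> `` {r X}" by metis
  then have "map r Xs \<in> tuples A n" and "Xs = map (\<lambda>x. \<theta> `` {x}) (map r Xs)"
    using assms by (auto simp: tuples_def map_idI)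
  then show ?thesis by (rule that)
qed

lemma algebra_over_quot_alg:
  assumes "algebra_over L A" and "congruence L A \<theta>"
  shows "algebra_over L (quot_alg A \<theta>)"
  unfolding algebra_over_def
proof (intro conjI allI impI ballI)
  show "univ (quot_alg A \<theta>) \<noteq> {}"
    using assms(1) by (auto simp: algebra_over_def quotient_def)
next
  fix f n Xs
  assume f: "L f = Some n" and "Xs \<in> tuples (univ (quot_alg A \<theta>)) n"
  then obtain xs where xs: "xs \<in> tuples (univ A) n" and Xs: "Xs = map (\<lambda>x. \<theta> `` {x}) xs"
    using classes_tuple by (metis univ_quot_alg)
  have hom: "homomorphism L A (quot_alg A \<theta>) (\<lambda>x. \<theta> `` {x})"
    using class_homomorphism[OF assms] .
  have "opr (quot_alg A \<theta>) f Xs = \<theta> `` {opr A f xs}"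
    using homomorphism_opr[OF hom f xs] Xs by simp
  then show "opr (quot_alg A \<theta>) f Xs \<in> univ (quot_alg A \<theta>)"
    using homomorphism_in_univ[OF hom opr_in_univ[OF assms(1) f xs]] by simp
qed

lemma quotient_factor:
  assumes A: "algebra_over L A" and \<theta>: "congruence L A \<theta>"
    and \<psi>: "homomorphism L A B \<psi>" and sub: "\<theta> \<subseteq> kernel (univ A) \<psi>"
  obtains \<phi> where "homomorphism L (quot_alg A \<theta>) B \<phi>"
    and "\<And>x. x \<in> univ A \<Longrightarrow> \<phi> (\<theta> `` {x}) = \<psi> x"
proof
  let ?\<phi> = "\<lambda>X. \<psi> (SOME x. x \<in> X)"
  show val: "?\<phi> (\<theta> `` {x}) = \<psi> x" if "x \<in> univ A" for x
    using SOME_in_class[OF congruence_equiv[OF \<theta>] that] sub by (auto simp: kernel_def)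
  have cls: "homomorphism L A (quot_alg A \<theta>) (\<lambda>x. \<theta> `` {x})"
    using class_homomorphism[OF A \<theta>] .
  show "homomorphism L (quot_alg A \<theta>) B ?\<phi>"
    unfolding homomorphism_def
  proof (intro conjI allI impI ballI)
    show "?\<phi> \<in> univ (quot_alg A \<theta>) \<rightarrow> univ B"
    proof
      fix X assume "X \<in> univ (quot_alg A \<theta>)"
      then obtain x where "x \<in> univ A" and "X = \<theta> `` {x}" by (auto elim: quotientE)
      then show "?\<phi> X \<in> univ B" using val homomorphism_in_univ[OF \<psi>] by simp
    qed
  next
    fix f n Xs
    assume f: "L f = Some n" and "Xs \<in> tuples (univ (quot_alg A \<theta>)) n"
    then obtain xs where xs: "xs \<in> tuples (univ A) n" and Xs: "Xs = map (\<lambda>x. \<theta> `` {x}) xs"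
      using classes_tuple by (metis univ_quot_alg)
    have "?\<phi> (opr (quot_alg A \<theta>) f Xs) = ?\<phi> (\<theta> `` {opr A f xs})"
      using homomorphism_opr[OF cls f xs] Xs by simp
    also have "\<dots> = \<psi> (opr A f xs)" using val opr_in_univ[OF A f xs] by simp
    also have "\<dots> = opr B f (map \<psi> xs)" using homomorphism_opr[OF \<psi> f xs] .
    also have "map \<psi> xs = map ?\<phi> Xs"
      using xs val Xs by (auto simp: tuples_def)
    finally show "?\<phi> (opr (quot_alg A \<theta>) f Xs) = opr B f (map ?\<phi> Xs)" .
  qed
qed

section \<open>Kernels as relative congruences\<close>

lemma kernel_congruence:
  assumes "algebra_over L A" and "homomorphism L A B \<phi>"
  shows "congruence L A (kernel (univ A) \<phi>)"
  unfolding congruence_def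
proof (intro conjI allI impI ballI)
  show "equiv (univ A) (kernel (univ A) \<phi>)"
    by (auto simp: equiv_def kernel_def refl_on_def sym_def trans_def)
next
  fix f n xs ys
  assume f: "L f = Some n" and xs: "xs \<in> tuples (univ A) n" and ys: "ys \<in> tuples (univ A) n"
    and rel: "\<forall>i<n. (xs ! i, ys ! i) \<in> kernel (univ A) \<phi>"
  have "map \<phi> xs = map \<phi> ys"
    using xs ys rel by (auto simp: tuples_def kernel_def intro!: nth_equalityI)
  then show "(opr A f xs, opr A f ys) \<in> kernel (univ A) \<phi>"
    using homomorphism_opr[OF assms(2) f xs] homomorphism_opr[OF assms(2) f ys]
      opr_in_univ[OF assms(1) f xs] opr_in_univ[OF assms(1) f ys]
    by (simp add: kernel_def)
qed

text \<open>
  The quotient by the kernel embeds in the codomain, and quasiequations are inherited by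
  subalgebras: a valuation in the quotient lifts to \<open>A\<close>, and its equations are those of the
  composite valuation in \<open>B\<close>.
\<close>

lemma kernel_in_Con:
  assumes \<Sigma>: "\<Sigma> \<subseteq> quasiequations L" and A: "algebra_over L A"
    and B: "in_quasivariety L \<Sigma> B" and \<phi>: "homomorphism L A B \<phi>"
  shows "kernel (univ A) \<phi> \<in> Con L \<Sigma> A"
proof -
  let ?\<theta> = "kernel (univ A) \<phi>"
  have \<theta>: "congruence L A ?\<theta>" using kernel_congruence[OF A \<phi>] .
  have cls: "homomorphism L A (quot_alg A ?\<theta>) (\<lambda>x. ?\<theta> `` {x})"
    using class_homomorphism[OF A \<theta>] .
  have "satisfies (quot_alg A ?\<theta>) \<Phi>" if "\<Phi> \<in> \<Sigma>" for \<Phi>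
    unfolding satisfies_def
  proof (intro allI impI)
    fix h assume h: "range h \<subseteq> univ (quot_alg A ?\<theta>)"
      and prem: "\<forall>(p, q)\<in>set (fst \<Phi>). eval (quot_alg A ?\<theta>) h p = eval (quot_alg A ?\<theta>) h q"
    have "\<forall>i. \<exists>x\<in>univ A. h i = ?\<theta> `` {x}"
    proof
      fix i
      have "h i \<in> univ A // ?\<theta>" using h by auto
      then show "\<exists>x\<in>univ A. h i = ?\<theta> `` {x}" by (rule quotientE) blast
    qed
    then obtain g where g: "\<And>i. g i \<in> univ A" and hg: "h = (\<lambda>i. ?\<theta> `` {g i})" by metis
    have iff: "eval (quot_alg A ?\<theta>) h p = eval (quot_alg A ?\<theta>) h q \<longleftrightarrow>
        eval B (\<lambda>i. \<phi> (g i)) p = eval B (\<lambda>i. \<phi> (g i)) q"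
      if p: "p \<in> terms L UNIV" and q: "q \<in> terms L UNIV" for p q
    proof -
      have "eval (quot_alg A ?\<theta>) h p = eval (quot_alg A ?\<theta>) h q \<longleftrightarrow>
          ?\<theta> `` {eval A g p} = ?\<theta> `` {eval A g q}"
        using homomorphism_eval[OF A cls p, of g] homomorphism_eval[OF A cls q, of g] g hg by simp
      also have "\<dots> \<longleftrightarrow> \<phi> (eval A g p) = \<phi> (eval A g q)"
        using eq_equiv_class_iff[OF congruence_equiv[OF \<theta>]] eval_in_univ[OF A p, of g]
          eval_in_univ[OF A q, of g] g by (auto simp: kernel_def)
      finally show ?thesis
        using homomorphism_eval[OF A \<phi> p, of g] homomorphism_eval[OF A \<phi> q, of g] g by simp
    qed
    have tms: "\<forall>(s, t)\<in>insert (snd \<Phi>) (set (fst \<Phi>)). s \<in> terms L UNIV \<and> t \<in> terms L UNIV"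
      using subsetD[OF \<Sigma> that] by (auto simp: quasiequations_def)
    have "\<forall>(p, q)\<in>set (fst \<Phi>). eval B (\<lambda>i. \<phi> (g i)) p = eval B (\<lambda>i. \<phi> (g i)) q"
      using prem tms iff by fastforce
    moreover have "range (\<lambda>i. \<phi> (g i)) \<subseteq> univ B"
      using g homomorphism_in_univ[OF \<phi>] by auto
    ultimately have "eval B (\<lambda>i. \<phi> (g i)) (fst (snd \<Phi>)) = eval B (\<lambda>i. \<phi> (g i)) (snd (snd \<Phi>))"
      using B that by (auto simp: in_quasivariety_def satisfies_def)
    then show "eval (quot_alg A ?\<theta>) h (fst (snd \<Phi>)) = eval (quot_alg A ?\<theta>) h (snd (snd \<Phi>))"
      using iff tms by (auto simp: case_prod_beta)
  qed
  then show ?thesis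
    using \<theta> algebra_over_quot_alg[OF A \<theta>] by (simp add: Con_def in_quasivariety_def)
qed

text \<open>
  The kernel of the map onto a one-element algebra is a relative congruence.  Without it the
  intersection that defines the least relative congruence could range over the empty family.
\<close>

lemma Con_nonempty:
  assumes "\<Sigma> \<subseteq> quasiequations L" and "algebra_over L A"
  shows "Con L \<Sigma> A \<noteq> {}"
proof -
  let ?U = "\<lparr>univ = {()}, opr = \<lambda>_ _. ()\<rparr>"
  have "in_quasivariety L \<Sigma> ?U"
    by (auto simp: in_quasivariety_def algebra_over_def satisfies_def)
  moreover have "homomorphism L A ?U (\<lambda>_. ())" by (simp add: homomorphism_def)
  ultimately show ?thesis using kernel_in_Con[OF assms] by blast
qed

lemma Inter_Con_congruence:
  assumes "\<Sigma> \<subseteq> quasiequations L" and "algebra_over L A"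
  shows "congruence L A (\<Inter>(Con L \<Sigma> A))"
proof -
  have ne: "Con L \<Sigma> A \<noteq> {}" using Con_nonempty[OF assms] .
  have c: "congruence L A \<theta>" if "\<theta> \<in> Con L \<Sigma> A" for \<theta> using that by (simp add: Con_def)
  have e: "equiv (univ A) \<theta>" if "\<theta> \<in> Con L \<Sigma> A" for \<theta>
    using congruence_equiv[OF c[OF that]] .
  have "equiv (univ A) (\<Inter>(Con L \<Sigma> A))"
  proof (rule equivI)
    show "\<Inter>(Con L \<Sigma> A) \<subseteq> univ A \<times> univ A"
      using ne equiv_type[OF e] by blast
    show "refl_on (univ A) (\<Inter>(Con L \<Sigma> A))"
      using e unfolding refl_on_def equiv_def by blast
    show "sym (\<Inter>(Con L \<Sigma> A))"
      using e unfolding sym_def equiv_def by blast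
    show "trans (\<Inter>(Con L \<Sigma> A))"
      using e unfolding trans_def equiv_def by blast
  qed
  moreover have "(opr A f xs, opr A f ys) \<in> \<Inter>(Con L \<Sigma> A)"
    if "L f = Some n" "xs \<in> tuples (univ A) n" "ys \<in> tuples (univ A) n"
      "\<forall>i<n. (xs ! i, ys ! i) \<in> \<Inter>(Con L \<Sigma> A)" for f n xs ys
    using c that unfolding congruence_def by blast
  ultimately show ?thesis unfolding congruence_def by blast
qed

section \<open>The free algebra\<close>

definition generator :: "'f signature \<Rightarrow> 'f quasiequation set \<Rightarrow> nat \<Rightarrow> ('f, nat) trm set" where
  "generator L \<Sigma> i = \<Inter>(Con L \<Sigma> (term_algebra L)) `` {Var i}"

lemma algebra_over_term_algebra: "algebra_over L (term_algebra L)"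
  by (auto simp: algebra_over_def term_algebra_def tuples_def intro: terms.intros)

lemma algebra_over_free_algebra:
  assumes "\<Sigma> \<subseteq> quasiequations L"
  shows "algebra_over L (free_algebra L \<Sigma>)"
  unfolding free_algebra_def
  using algebra_over_quot_alg Inter_Con_congruence[OF assms] algebra_over_term_algebra by blast

lemma generator_in_univ: "generator L \<Sigma> i \<in> univ (free_algebra L \<Sigma>)"
  by (auto simp: generator_def free_algebra_def term_algebra_def intro!: quotientI terms.Var)

lemma eval_homomorphism:
  assumes "algebra_over L A" and "range h \<subseteq> univ A"
  shows "homomorphism L (term_algebra L) A (eval A h)"
  using eval_in_univ[OF assms(1), of _ UNIV h] assms(2)
  by (auto simp: homomorphism_def term_algebra_def range_subsetD)

text \<open>
  The universal property of the free algebra.  Evaluation of terms is a homomorphism from the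
  absolutely free algebra whose kernel is a relative congruence, so the kernel contains the least
  one and evaluation factors through the quotient by it.
\<close>

lemma free_extension:
  assumes \<Sigma>: "\<Sigma> \<subseteq> quasiequations L" and A: "in_quasivariety L \<Sigma> A" and h: "range h \<subseteq> univ A"
  obtains \<phi> where "homomorphism L (free_algebra L \<Sigma>) A \<phi>"
    and "\<And>i. \<phi> (generator L \<Sigma> i) = h i"
proof -
  let ?\<rho> = "\<Inter>(Con L \<Sigma> (term_algebra L))"
  note TA = algebra_over_term_algebra[of L]
  have ev: "homomorphism L (term_algebra L) A (eval A h)"
    using eval_homomorphism A h by (auto simp: in_quasivariety_def)
  have "?\<rho> \<subseteq> kernel (univ (term_algebra L)) (eval A h)"
    using kernel_in_Con[OF \<Sigma> TA A ev] by blast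
  then obtain \<phi> where \<phi>: "homomorphism L (quot_alg (term_algebra L) ?\<rho>) A \<phi>"
      and val: "\<And>u. u \<in> univ (term_algebra L) \<Longrightarrow> \<phi> (?\<rho> `` {u}) = eval A h u"
    using quotient_factor[OF TA Inter_Con_congruence[OF \<Sigma> TA] ev] by blast
  have "\<phi> (generator L \<Sigma> i) = h i" for i
    using val[of "Var i"] by (simp add: generator_def term_algebra_def terms.Var)
  then show ?thesis using that \<phi> by (simp add: free_algebra_def)
qed

section \<open>Term operations and reducts\<close>

definition subst :: "('v \<Rightarrow> ('f, 'w) trm) \<Rightarrow> ('f, 'v) trm \<Rightarrow> ('f, 'w) trm" where
  "subst s = eval \<lparr>univ = UNIV, opr = App\<rparr> s"

lemma subst_in_terms:
  assumes "t \<in> terms L X" and "\<And>x. x \<in> X \<Longrightarrow> s x \<in> terms L Y"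
  shows "subst s t \<in> terms L Y"
  using assms(1)
  by (induction rule: terms.induct) (auto simp: subst_def assms(2) intro!: terms.App)

lemma eval_subst: "eval A h (subst s t) = eval A (\<lambda>x. eval A h (s x)) t"
proof (induction t)
  case (App f ts)
  then have "map (eval A h) (map (subst s) ts) = map (eval A (\<lambda>x. eval A h (s x))) ts" by simp
  moreover have "subst s (App f ts) = App f (map (subst s) ts)" by (simp add: subst_def)
  ultimately show ?case by (simp del: map_map map_eq_conv)
qed (simp add: subst_def)

lemma term_operation_in_operations:
  assumes "algebra_over L A" and "t \<in> terms L {..<n}"
  shows "(n, term_operation A n t) \<in> operations (univ A)"
  using eval_in_univ[OF assms]
  by (auto simp: operations_def term_operation_def tuples_def subset_iff)

text \<open>
  Superposition of term operations is substitution of the terms, and the projections come from the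
  variables.
\<close>

lemma clone_term_operations:
  assumes A: "algebra_over L A"
  shows "clone (univ A) {(n, term_operation A n t) | n t. t \<in> terms L {..<n}}"
    (is "clone _ ?D")
  unfolding clone_def
proof (intro conjI allI impI)
  show "?D \<subseteq> operations (univ A)" using term_operation_in_operations[OF A] by auto
next
  fix n i :: nat assume "i < n"
  then have "Var i \<in> terms L {..<n}" by (simp add: terms.Var)
  moreover have "projection (univ A) n i = term_operation A n (Var i)"
    by (simp add: projection_def term_operation_def)
  ultimately show "(n, projection (univ A) n i) \<in> ?D" by blast
next
  fix m n f gs
  assume "(n, f) \<in> ?D \<and> length gs = n \<and> (\<forall>g\<in>set gs. (m, g) \<in> ?D)"
  then obtain t where t: "t \<in> terms L {..<n}" and f: "f = term_operation A n t"
      and n: "length gs = n" and "\<forall>g\<in>set gs. \<exists>u. u \<in> terms L {..<m} \<and> g = term_operation A m u"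
    by blast
  then obtain r where r: "\<And>g. g \<in> set gs \<Longrightarrow> r g \<in> terms L {..<m}"
      and g: "\<And>g. g \<in> set gs \<Longrightarrow> g = term_operation A m (r g)" by metis
  let ?u = "subst (\<lambda>i. r (gs ! i)) t"
  have u: "?u \<in> terms L {..<m}" by (rule subst_in_terms[OF t]) (simp add: r n)
  have "superposition (univ A) m f gs = term_operation A m ?u"
    unfolding superposition_def term_operation_def
  proof (rule restrict_ext)
    fix xs assume xs: "xs \<in> tuples (univ A) m"
    have gx: "g xs = eval A ((!) xs) (r g)" if "g \<in> set gs" for g
      using fun_cong[OF g[OF that], of xs] xs by (simp add: term_operation_def)
    have "eval A ((!) xs) (r g) \<in> univ A" if "g \<in> set gs" for g
      using eval_in_univ[OF A r[OF that], of "(!) xs"] xs by (auto simp: tuples_def subset_iff)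
    then have "map (\<lambda>g. g xs) gs \<in> tuples (univ A) n"
      using gx n by (auto simp: tuples_def)
    then have "f (map (\<lambda>g. g xs) gs) = eval A ((!) (map (\<lambda>g. g xs) gs)) t"
      by (simp add: f term_operation_def)
    also have "\<dots> = eval A (\<lambda>i. eval A ((!) xs) (r (gs ! i))) t"
      by (rule eval_cong_terms[OF t]) (simp add: gx n)
    finally show "f (map (\<lambda>g. g xs) gs) = eval A ((!) xs) ?u" by (simp add: eval_subst)
  qed
  then show "(m, superposition (univ A) m f gs) \<in> ?D" using u by auto
qed

lemma clone_generated_least:
  assumes "clone A D" and "G \<subseteq> D"
  shows "clone_generated A G \<subseteq> D"
  using assms by (auto simp: clone_generated_def)

text \<open>
  The term operations of the free algebra form a clone that contains the fundamental operations,
  hence it contains the clone that these generate.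
\<close>

lemma term_clone_represented:
  assumes "\<Sigma> \<subseteq> quasiequations L" and "(n, f) \<in> term_clone L \<Sigma>"
  shows "\<exists>t. t \<in> terms L {..<n} \<and> term_operation (free_algebra L \<Sigma>) n t = f"
proof -
  let ?F = "free_algebra L \<Sigma>"
  let ?D = "{(n, term_operation ?F n t) | n t. t \<in> terms L {..<n}}"
  have "(n, restrict (opr ?F f) (tuples (univ ?F) n)) \<in> ?D" if f: "L f = Some n" for f n
  proof -
    have "App f (map Var [0..<n]) \<in> terms L {..<n}"
      using f by (auto intro!: terms.intros)
    moreover have "restrict (opr ?F f) (tuples (univ ?F) n) =
        term_operation ?F n (App f (map Var [0..<n]))"
      unfolding term_operation_def
    proof (rule restrict_ext)
      fix xs assume "xs \<in> tuples (univ ?F) n"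
      then have "map ((!) xs) [0..<n] = xs" using map_nth[of xs] by (simp add: tuples_def)
      then show "opr ?F f xs = eval ?F ((!) xs) (App f (map Var [0..<n]))"
        by (simp add: comp_def)
    qed
    ultimately show ?thesis by blast
  qed
  then have "fundamental_operations L ?F \<subseteq> ?D" by (auto simp: fundamental_operations_def)
  then have "term_clone L \<Sigma> \<subseteq> ?D"
    unfolding term_clone_def
    using clone_generated_least clone_term_operations algebra_over_free_algebra[OF assms(1)]
    by blast
  then show ?thesis using assms(2) by auto
qed

text \<open>
  The term does not depend on the algebra in which an operation is interpreted.  As a constant it
  can be used for algebras with carriers of different types at once, as the comparison of two
  reducts along a homomorphism requires.
\<close>

definition representing_term ::
    "'f signature \<Rightarrow> 'f quasiequation set \<Rightarrow> ('f, nat) trm set operation \<Rightarrow> ('f, nat) trm" where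
  "representing_term L \<Sigma> = (\<lambda>(n, f).
     SOME t. t \<in> terms L {..<n} \<and> term_operation (free_algebra L \<Sigma>) n t = f)"

lemma representing_term:
  assumes "\<Sigma> \<subseteq> quasiequations L" and "(n, f) \<in> term_clone L \<Sigma>"
  shows "representing_term L \<Sigma> (n, f) \<in> terms L {..<n}"
    and "term_operation (free_algebra L \<Sigma>) n (representing_term L \<Sigma> (n, f)) = f"
  using someI_ex[OF term_clone_represented[OF assms]] by (auto simp: representing_term_def)

lemma interpretation_in_eq_term_operation:
  "interpretation_in L \<Sigma> A (n, f) = term_operation A n (representing_term L \<Sigma> (n, f))"
  by (simp add: interpretation_in_def representing_term_def)

lemma interpretation_in_free_algebra:
  assumes "\<Sigma> \<subseteq> quasiequations L" and "(n, f) \<in> term_clone L \<Sigma>"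
  shows "interpretation_in L \<Sigma> (free_algebra L \<Sigma>) (n, f) = f"
  using representing_term(2)[OF assms] by (simp add: interpretation_in_eq_term_operation)

lemma algebra_over_clone_reduct:
  assumes \<Sigma>: "\<Sigma> \<subseteq> quasiequations L" and C: "C \<subseteq> term_clone L \<Sigma>" and A: "algebra_over L A"
  shows "algebra_over (clone_sig C) (clone_reduct L \<Sigma> A)"
  unfolding algebra_over_def
proof (intro conjI allI impI ballI)
  show "univ (clone_reduct L \<Sigma> A) \<noteq> {}"
    using A by (simp add: algebra_over_def clone_reduct_def)
next
  fix c n xs
  assume "clone_sig C c = Some n" and xs: "xs \<in> tuples (univ (clone_reduct L \<Sigma> A)) n"
  then obtain f where c: "c = (n, f)" and "(n, f) \<in> term_clone L \<Sigma>"
    using C by (cases c) (auto simp: clone_sig_def split: if_splits)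
  then have "representing_term L \<Sigma> (n, f) \<in> terms L {..<n}"
    using representing_term(1)[OF \<Sigma>] by blast
  then show "opr (clone_reduct L \<Sigma> A) c xs \<in> univ (clone_reduct L \<Sigma> A)"
    using term_operation_in_operations[OF A] xs c
    by (fastforce simp: operations_def clone_reduct_def interpretation_in_eq_term_operation)
qed

text \<open>
  A homomorphism commutes with all term operations, and both algebras interpret a member of \<open>C\<close> by
  one and the same term.
\<close>

lemma homomorphism_clone_reduct:
  assumes \<Sigma>: "\<Sigma> \<subseteq> quasiequations L" and C: "C \<subseteq> term_clone L \<Sigma>"
    and A: "algebra_over L A" and \<phi>: "homomorphism L A B \<phi>"
  shows "homomorphism (clone_sig C) (clone_reduct L \<Sigma> A) (clone_reduct L \<Sigma> B) \<phi>"
  unfolding homomorphism_def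
proof (intro conjI allI impI ballI)
  show "\<phi> \<in> univ (clone_reduct L \<Sigma> A) \<rightarrow> univ (clone_reduct L \<Sigma> B)"
    using homomorphism_in_univ[OF \<phi>] by (simp add: clone_reduct_def)
next
  fix c n xs
  assume "clone_sig C c = Some n" and xs: "xs \<in> tuples (univ (clone_reduct L \<Sigma> A)) n"
  then obtain f where c: "c = (n, f)" and "(n, f) \<in> term_clone L \<Sigma>"
    using C by (cases c) (auto simp: clone_sig_def split: if_splits)
  then have t: "representing_term L \<Sigma> (n, f) \<in> terms L {..<n}" (is "?t \<in> _")
    using representing_term(1)[OF \<Sigma>] by blast
  have xsA: "xs \<in> tuples (univ A) n" using xs by (simp add: clone_reduct_def)
  have xsB: "map \<phi> xs \<in> tuples (univ B) n"
    using map_in_tuples[OF xsA] homomorphism_in_univ[OF \<phi>] by blast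
  have "\<phi> (eval A ((!) xs) ?t) = eval B (\<lambda>i. \<phi> (xs ! i)) ?t"
    using homomorphism_eval[OF A \<phi> t] xsA by (auto simp: tuples_def subset_iff)
  also have "\<dots> = eval B ((!) (map \<phi> xs)) ?t"
    by (rule eval_cong_terms[OF t]) (use xsA in \<open>auto simp: tuples_def\<close>)
  finally show "\<phi> (opr (clone_reduct L \<Sigma> A) c xs) = opr (clone_reduct L \<Sigma> B) c (map \<phi> xs)"
    using c xsA xsB
    by (simp add: clone_reduct_def interpretation_in_eq_term_operation term_operation_def)
qed

text \<open>
  Because of this, whether a map is an endomorphism of a reduct depends only on the clone that the
  operations of the reduct generate.
\<close>

lemma clone_commuting_operations:
  assumes "\<sigma> \<in> A \<rightarrow> A"
  shows "clone A {(n, f) \<in> operations A. \<forall>xs\<in>tuples A n. \<sigma> (f xs) = f (map \<sigma> xs)}"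
    (is "clone _ ?D")
  unfolding clone_def
proof (intro conjI allI impI)
  show "?D \<subseteq> operations A" by auto
next
  fix n i :: nat assume "i < n"
  then show "(n, projection A n i) \<in> ?D"
    using assms by (auto simp: projection_def operations_def tuples_def subset_iff Pi_iff)
next
  fix m n f gs
  assume "(n, f) \<in> ?D \<and> length gs = n \<and> (\<forall>g\<in>set gs. (m, g) \<in> ?D)"
  then have f: "f \<in> tuples A n \<rightarrow> A"
      and fc: "\<And>xs. xs \<in> tuples A n \<Longrightarrow> \<sigma> (f xs) = f (map \<sigma> xs)" and n: "length gs = n"
      and g: "\<And>g. g \<in> set gs \<Longrightarrow> g \<in> tuples A m \<rightarrow> A"
      and gc: "\<And>g xs. g \<in> set gs \<Longrightarrow> xs \<in> tuples A m \<Longrightarrow> \<sigma> (g xs) = g (map \<sigma> xs)"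
    by (auto simp: operations_def PiE_iff)
  have gx: "map (\<lambda>g. g xs) gs \<in> tuples A n" if "xs \<in> tuples A m" for xs
    using g n that by (auto simp: tuples_def)
  have "\<sigma> (f (map (\<lambda>g. g xs) gs)) = f (map (\<lambda>g. g (map \<sigma> xs)) gs)" if "xs \<in> tuples A m" for xs
  proof -
    have "map \<sigma> (map (\<lambda>g. g xs) gs) = map (\<lambda>g. g (map \<sigma> xs)) gs" using gc that by simp
    then show ?thesis using fc[OF gx[OF that]] by argo
  qed
  moreover have "map \<sigma> xs \<in> tuples A m" if "xs \<in> tuples A m" for xs
    using map_in_tuples[OF that] assms by blast
  ultimately show "(m, superposition A m f gs) \<in> ?D"
    using f gx by (auto simp: superposition_def operations_def)
qed

lemma endomorphism_of_generated_reduct: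
  assumes \<Sigma>: "\<Sigma> \<subseteq> quasiequations L" and C: "clone_of_term_operations L \<Sigma> C" and T: "T \<subseteq> C"
    and gen: "clone_generated (univ (free_algebra L \<Sigma>)) T = C"
    and \<sigma>: "endomorphism (clone_sig T) (clone_reduct L \<Sigma> (free_algebra L \<Sigma>)) \<sigma>"
  shows "endomorphism (clone_sig C) (clone_reduct L \<Sigma> (free_algebra L \<Sigma>)) \<sigma>"
proof -
  let ?U = "univ (free_algebra L \<Sigma>)" and ?R = "clone_reduct L \<Sigma> (free_algebra L \<Sigma>)"
  let ?D = "{(n, f) \<in> operations ?U. \<forall>xs\<in>tuples ?U n. \<sigma> (f xs) = f (map \<sigma> xs)}"
  have ops: "C \<subseteq> operations ?U" and tc: "C \<subseteq> term_clone L \<Sigma>"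
    using C by (auto simp: clone_of_term_operations_def clone_def)
  have int: "interpretation_in L \<Sigma> (free_algebra L \<Sigma>) (n, f) = f" if "(n, f) \<in> C" for n f
    using interpretation_in_free_algebra[OF \<Sigma>] that tc by blast
  have self: "\<sigma> \<in> ?U \<rightarrow> ?U" using \<sigma> by (simp add: endomorphism_def clone_reduct_def)
  have "T \<subseteq> ?D"
  proof
    fix c assume cT: "c \<in> T"
    obtain n f where c: "c = (n, f)" by fastforce
    have "clone_sig T c = Some n" using cT c by (simp add: clone_sig_def)
    then have "\<forall>xs\<in>tuples ?U n. \<sigma> (opr ?R c xs) = opr ?R c (map \<sigma> xs)"
      using homomorphism_opr[of _ ?R ?R \<sigma>] \<sigma>
      by (simp add: endomorphism_iff_homomorphism clone_reduct_def)
    moreover have "opr ?R c = f" using int cT T c by (auto simp: clone_reduct_def)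
    ultimately have "\<forall>xs\<in>tuples ?U n. \<sigma> (f xs) = f (map \<sigma> xs)" by simp
    then show "c \<in> ?D" using cT T ops c by blast
  qed
  then have "C \<subseteq> ?D" using clone_generated_least[OF clone_commuting_operations[OF self]] gen by blast
  then have comm: "\<sigma> (f xs) = f (map \<sigma> xs)" if "(n, f) \<in> C" "xs \<in> tuples ?U n" for n f xs
    using that by blast
  have "\<sigma> (opr ?R c xs) = opr ?R c (map \<sigma> xs)"
    if c: "clone_sig C c = Some n" and xs: "xs \<in> tuples ?U n" for c n xs
  proof -
    obtain f where "c = (n, f)" and "(n, f) \<in> C"
      using c by (cases c) (auto simp: clone_sig_def split: if_splits)
    then show ?thesis using int comm xs by (simp add: clone_reduct_def)
  qed
  moreover have "univ ?R = ?U" by (simp add: clone_reduct_def)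
  ultimately show ?thesis using self unfolding endomorphism_def by auto
qed

section \<open>Structural completeness\<close>

lemma join_principal_Con_contains:
  assumes "i < n"
  shows "(a ! i, b ! i) \<in> join_Con L \<Sigma> A {principal_Con L \<Sigma> A (a ! i) (b ! i) | i. i < n}"
  using assms by (auto simp: join_Con_def principal_Con_def)

lemma join_principal_Con_least:
  assumes "\<theta> \<in> Con L \<Sigma> A" and "\<And>i. i < n \<Longrightarrow> (a ! i, b ! i) \<in> \<theta>"
  shows "join_Con L \<Sigma> A {principal_Con L \<Sigma> A (a ! i) (b ! i) | i. i < n} \<subseteq> \<theta>"
  using assms unfolding join_Con_def principal_Con_def by blast

theorem theorem4p9:
  fixes L :: "'f signature"
    and \<Sigma> :: "'f quasiequation set"
    and C T :: "('f, nat) trm set operation set"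
  assumes "\<Sigma> \<subseteq> quasiequations L"
    and "clone_of_term_operations L \<Sigma> C"
    and "T \<subseteq> C"
    and "clone_generated (univ (free_algebra L \<Sigma>)) T = C"
    and "prucnal_property L \<Sigma> T (free_algebra L \<Sigma>)"
  shows "structurally_complete TYPE('b) L \<Sigma> C"
  unfolding structurally_complete_def
proof (intro ballI allI impI)
  fix \<Phi> and A :: "('f, 'b) algebra"
  let ?F = "free_algebra L \<Sigma>"
  let ?FC = "clone_reduct L \<Sigma> ?F" and ?AC = "clone_reduct L \<Sigma> A"
  let ?x = "generator L \<Sigma>"
  assume \<Phi>: "\<Phi> \<in> quasiequations (clone_sig C)" and valid: "satisfies ?FC \<Phi>"
    and A: "in_quasivariety L \<Sigma> A"
  obtain ps s t where \<Phi>_eq: "\<Phi> = (ps, (s, t))" by (cases \<Phi>) auto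
  have ps: "\<And>p q. (p, q) \<in> set ps \<Longrightarrow>
        p \<in> terms (clone_sig C) UNIV \<and> q \<in> terms (clone_sig C) UNIV"
      and s: "s \<in> terms (clone_sig C) UNIV" and t: "t \<in> terms (clone_sig C) UNIV"
    using \<Phi> \<Phi>_eq by (auto simp: quasiequations_def)
  have tc: "C \<subseteq> term_clone L \<Sigma>" using assms(2) by (simp add: clone_of_term_operations_def)
  have F: "algebra_over L ?F" using algebra_over_free_algebra[OF assms(1)] .
  have FC: "algebra_over (clone_sig C) ?FC" using algebra_over_clone_reduct[OF assms(1) tc F] .
  have univ_FC [simp]: "univ ?FC = univ ?F" by (simp add: clone_reduct_def)
  have x: "?x i \<in> univ ?FC" for i using generator_in_univ by simp
  have ev: "eval ?FC ?x p \<in> univ ?F" if "p \<in> terms (clone_sig C) UNIV" for p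
    using eval_in_univ[OF FC that, of ?x] x by simp
  show "satisfies ?AC \<Phi>"
    unfolding satisfies_def
  proof (intro allI impI)
    fix h assume h: "range h \<subseteq> univ ?AC"
      and prem: "\<forall>(p, q)\<in>set (fst \<Phi>). eval ?AC h p = eval ?AC h q"
    obtain \<phi> where \<phi>: "homomorphism L ?F A \<phi>" and \<phi>x: "\<And>i. \<phi> (?x i) = h i"
      using free_extension[OF assms(1) A] h by (auto simp: clone_reduct_def)
    have \<phi>_eval: "\<phi> (eval ?FC ?x p) = eval ?AC h p" if "p \<in> terms (clone_sig C) UNIV" for p
      using homomorphism_eval[OF FC homomorphism_clone_reduct[OF assms(1) tc F \<phi>] that, of ?x]
        x \<phi>x by simp
    \<comment> \<open>The trivial pair in front makes the number of pairs positive, as the Prucnal property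
        requires, even for a quasiequation with no premises.\<close>
    let ?a = "?x 0 # map (\<lambda>(p, q). eval ?FC ?x p) ps"
    let ?b = "?x 0 # map (\<lambda>(p, q). eval ?FC ?x q) ps"
    let ?n = "Suc (length ps)"
    let ?\<theta> = "join_Con L \<Sigma> ?F {principal_Con L \<Sigma> ?F (?a ! i) (?b ! i) | i. i < ?n}"
    have a: "?a \<in> tuples (univ ?F) ?n" and b: "?b \<in> tuples (univ ?F) ?n"
      using x ev ps by (auto simp: tuples_def)
    have "?n \<ge> 1" by simp
    then obtain \<sigma> where \<sigma>T: "endomorphism (clone_sig T) ?FC \<sigma>" and ker: "kernel (univ ?F) \<sigma> = ?\<theta>"
      using assms(5) a b unfolding prucnal_property_def Let_def by meson
    have \<sigma>: "homomorphism (clone_sig C) ?FC ?FC \<sigma>"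
      using endomorphism_of_generated_reduct[OF assms(1-4) \<sigma>T]
      by (simp add: endomorphism_iff_homomorphism)
    have \<sigma>_eval: "\<sigma> (eval ?FC ?x p) = eval ?FC (\<lambda>i. \<sigma> (?x i)) p"
      if "p \<in> terms (clone_sig C) UNIV" for p
      using homomorphism_eval[OF FC \<sigma> that] x by simp
    have unified: "eval ?FC (\<lambda>i. \<sigma> (?x i)) p = eval ?FC (\<lambda>i. \<sigma> (?x i)) q"
      if pq: "(p, q) \<in> set ps" for p q
    proof -
      obtain j where "j < length ps" and "ps ! j = (p, q)" using pq by (auto simp: in_set_conv_nth)
      then have "(eval ?FC ?x p, eval ?FC ?x q) \<in> ?\<theta>"
        using join_principal_Con_contains[of "Suc j" ?n ?a ?b L \<Sigma> ?F] by simp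
      then have "\<sigma> (eval ?FC ?x p) = \<sigma> (eval ?FC ?x q)" using ker by (auto simp: kernel_def)
      then show ?thesis using \<sigma>_eval ps[OF pq] by simp
    qed
    have "range (\<lambda>i. \<sigma> (?x i)) \<subseteq> univ ?FC" using homomorphism_in_univ[OF \<sigma>] x by blast
    moreover have "\<forall>(p, q)\<in>set (fst \<Phi>).
        eval ?FC (\<lambda>i. \<sigma> (?x i)) p = eval ?FC (\<lambda>i. \<sigma> (?x i)) q"
      using unified \<Phi>_eq by (simp add: case_prod_beta)
    ultimately have "eval ?FC (\<lambda>i. \<sigma> (?x i)) s = eval ?FC (\<lambda>i. \<sigma> (?x i)) t"
      using valid[unfolded satisfies_def, rule_format, of "\<lambda>i. \<sigma> (?x i)"] \<Phi>_eq by simp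
    then have st: "(eval ?FC ?x s, eval ?FC ?x t) \<in> ?\<theta>"
      using \<sigma>_eval s t ev ker[symmetric] by (simp add: kernel_def)
    have "(?a ! i, ?b ! i) \<in> kernel (univ ?F) \<phi>" if i: "i < ?n" for i
    proof (cases i)
      case 0
      then show ?thesis using x by (simp add: kernel_def)
    next
      case (Suc j)
      obtain p q where pq: "ps ! j = (p, q)" by fastforce
      then have "(p, q) \<in> set ps" using i Suc by (metis Suc_less_eq nth_mem)
      then have "(eval ?FC ?x p, eval ?FC ?x q) \<in> kernel (univ ?F) \<phi>"
        using ev ps \<phi>_eval prem \<Phi>_eq by (fastforce simp: kernel_def)
      then show ?thesis using Suc i pq by simp
    qed
    then have "?\<theta> \<subseteq> kernel (univ ?F) \<phi>"
      using join_principal_Con_least[OF kernel_in_Con[OF assms(1) F A \<phi>]] by blast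
    then have "\<phi> (eval ?FC ?x s) = \<phi> (eval ?FC ?x t)" using st by (auto simp: kernel_def)
    then show "eval ?AC h (fst (snd \<Phi>)) = eval ?AC h (snd (snd \<Phi>))"
      using \<phi>_eval s t \<Phi>_eq by simp
  qed
qed

end
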